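(* Let $x\in\mathbb{B}^n$ and $0<r<1-|x|$. Then $B_h(x,l_0)\subseteq B^n(x,r)\subseteq B_h(x,l_1)\subsetneq\mathbb{B}^n$ holds if and only if both of the following hold: $$l_0\le\begin{cases}\log\dfrac{(1+|x|)(1-|x|+r)}{(1-|x|)(1+|x|-r)}&\text{if }|x|\le r,\\[3mm]\log\dfrac{(1-|x|^2)\sqrt{r^2+1-|x|^2}}{\left(\sqrt{r^2+1-|x|^2}-r\right)\left(1-|x|^2-r\left(\sqrt{r^2+1-|x|^2}-r\right)\right)}&\text{if }|x|>r,\end{cases}$$ $$l_1\ge\log\frac{(1-|x|)(1+|x|+r)}{(1+|x|)(1-|x|-r)}.$$
   Context: Let $n\ge 2$ and let $\mathbb{B}^n$ be the open Euclidean unit ball in $\mathbb{R}^n$, with boundary sphere $S^{n-1}$. For distinct $x,y\in\mathbb{R}^n$, $L(x,y)$ denotes the Euclidean line through $x$ and $y$. Hilbert metric: for distinct $x,y\in\mathbb{B}^n$, $$h_{\mathbb{B}^n}(x,y)=\log\frac{|u-y|\,|x-v|}{|u-x|\,|y-v|},$$ where $u,v$ are the two points of $L(x,y)\cap S^{n-1}$, ordered so that $|u-x|<|u-y|$; and $h_{\mathbb{B}^n}(x,x)=0$. The logarithm is natural. Balls: $B^n(x,r)=\{y\in\mathbb{R}^n:|x-y|<r\}$ is the open Euclidean ball and $B_h(x,l)=\{y\in\mathbb{B}^n: h_{\mathbb{B}^n}(x,y)<l\}$ is the open ball in the Hilbert metric; $l_0,l_1$ are real radii. *)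

theory Defs
  imports "HOL-Analysis.Analysis"
begin

(* The line L(x,y) is affine hull {x, y}. For distinct x, y in the open unit ball there is
   exactly one pair (u, v) as below; the value is only meaningful for such x, y. *)
definition chord_ends :: "'a::euclidean_space \<Rightarrow> 'a \<Rightarrow> 'a \<times> 'a" where
  "chord_ends x y =
     (THE (u, v). u \<noteq> v \<and> affine hull {x, y} \<inter> sphere 0 1 = {u, v} \<and>
                  norm (u - x) < norm (u - y))"

definition hilbert_dist :: "'a::euclidean_space \<Rightarrow> 'a \<Rightarrow> real" where
  "hilbert_dist x y =
     (if x = y then 0
      else case chord_ends x y of (u, v) \<Rightarrow>
        ln ((norm (u - y) * norm (x - v)) / (norm (u - x) * norm (y - v))))"

definition hilbert_ball :: "'a::euclidean_space \<Rightarrow> real \<Rightarrow> 'a set" where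
  "hilbert_ball x l = {y \<in> ball 0 1. hilbert_dist x y < l}"

end

theory Submission
  imports Defs
begin

text \<open>
  Up to the increasing function \<open>2 * artanh\<close>, the Hilbert distance is an algebraic function of
  the two points. The unit ball with this metric is the Klein model of hyperbolic space, and
  \<open>hilbert_dist x y = 2 * artanh (hilbert_ratio x y)\<close> (lemma \<open>hilbert_dist_eq_artanh\<close>), where the
  ratio is obtained by solving the quadratic equation for the ends of the chord. Every comparison
  of balls thereby becomes a comparison of ratios on the Euclidean sphere \<open>sphere x r\<close>.

  Write \<open>k = 1 - (norm x)\<^sup>2\<close>. At \<open>y = x + t *\<^sub>R e\<close> with \<open>norm e = 1\<close> and \<open>c = x \<bullet> e\<close> the ratio is
  \<open>t * sqrt (c\<^sup>2 + k) / (k - t * c)\<close>. It increases with \<open>t\<close>, and its derivative in \<open>c\<close> has the sign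
  of \<open>c + t\<close>. Here \<open>c\<close> ranges over the interval from \<open>- norm x\<close> to \<open>norm x\<close>, and in dimension at
  least two it takes every value there. Hence, on the sphere of radius \<open>r\<close>:

  \<^item> The maximum is at \<open>c = norm x\<close>, the point farthest from the origin
    (\<open>hilbert_ratio_le_outward\<close>). The value at the other end, \<open>c = - norm x\<close>, is no larger. This
    gives the bound on \<open>l1\<close>. The open Euclidean ball does not contain the maximum point, but the
    Hilbert distances along that radius fill the whole interval up to the maximum
    (\<open>ex_outward_at_hilbert_dist\<close>), so no smaller \<open>l1\<close> will do.

  \<^item> If \<open>norm x \<le> r\<close>, the ratio increases with \<open>c\<close> on the whole interval, and the minimum is at
    \<open>c = - norm x\<close>, the direction of the origin (\<open>hilbert_ratio_ge_inward\<close>).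

  \<^item> If \<open>norm x > r\<close>, the critical value \<open>c = - r\<close> lies inside the interval, and the minimum
    \<open>r / sqrt (r\<^sup>2 + k)\<close> is attained there (\<open>hilbert_ratio_ge_critical\<close>).

  The two minima are the two cases of the bound on \<open>l0\<close>. The monotonicity in \<open>c\<close> enters only
  through polynomial identities for the difference of the squared ratios, so that no calculus is
  needed.
\<close>

section \<open>The Hilbert distance as an inverse hyperbolic tangent\<close>

text \<open>
  This is the hyperbolic tangent of half the Hilbert distance. It is written with \<open>y - x\<close> in the
  numerator because the spheres below are centred at \<open>x\<close>.
\<close>

definition hilbert_ratio :: "'a::euclidean_space \<Rightarrow> 'a \<Rightarrow> real" where
  "hilbert_ratio x y =
     sqrt ((x \<bullet> (y - x))\<^sup>2 + (1 - (norm x)\<^sup>2) * (norm (y - x))\<^sup>2) / (1 - x \<bullet> y)"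

lemma inner_less_one:
  fixes x y :: "'a::real_inner"
  assumes "norm x < 1" "norm y < 1"
  shows "x \<bullet> y < 1"
proof -
  have "norm x * norm y < 1 * 1"
    using assms by (intro mult_strict_mono') auto
  then show ?thesis
    using norm_cauchy_schwarz[of x y] by linarith
qed

lemma norm_less_one_imp_sq: "norm x < 1 \<Longrightarrow> 0 < 1 - (norm x)\<^sup>2"
  by (simp add: abs_square_less_1)

lemma norm_affine_sq:
  fixes x d :: "'a::real_inner"
  shows "(norm (x + s *\<^sub>R d))\<^sup>2 = (norm x)\<^sup>2 + 2 * s * (x \<bullet> d) + s\<^sup>2 * (norm d)\<^sup>2"
  unfolding power2_norm_eq_inner
  by (simp add: inner_add_left inner_add_right inner_commute[of d x] power2_eq_square algebra_simps)

text \<open>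
  With \<open>A\<close> for the expression under the root,
  \<open>(1 - x \<bullet> y)\<^sup>2 - A = (1 - (norm x)\<^sup>2) * (1 - (norm y)\<^sup>2)\<close>, which is positive inside the unit ball.
\<close>

lemma hilbert_ratio_less_one:
  fixes x y :: "'a::euclidean_space"
  assumes "norm x < 1" "norm y < 1"
  shows "hilbert_ratio x y < 1"
proof -
  have xy: "x \<bullet> y < 1"
    using assms by (rule inner_less_one)
  have "(1 - x \<bullet> y)\<^sup>2 - ((x \<bullet> (y - x))\<^sup>2 + (1 - (norm x)\<^sup>2) * (norm (y - x))\<^sup>2)
        = (1 - (norm x)\<^sup>2) * (1 - (norm y)\<^sup>2)"
    unfolding power2_norm_eq_inner
    by (simp add: inner_diff_left inner_diff_right inner_commute[of y x]
        power2_eq_square algebra_simps)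
  moreover have "\<dots> > 0"
    using assms by (intro mult_pos_pos norm_less_one_imp_sq)
  ultimately have "(x \<bullet> (y - x))\<^sup>2 + (1 - (norm x)\<^sup>2) * (norm (y - x))\<^sup>2 < (1 - x \<bullet> y)\<^sup>2"
    by linarith
  then have "sqrt ((x \<bullet> (y - x))\<^sup>2 + (1 - (norm x)\<^sup>2) * (norm (y - x))\<^sup>2) < 1 - x \<bullet> y"
    using xy by (intro real_less_lsqrt) auto
  then show ?thesis
    using xy by (simp add: hilbert_ratio_def)
qed

lemma hilbert_ratio_nonneg:
  fixes x y :: "'a::euclidean_space"
  assumes "norm x < 1" "norm y < 1"
  shows "0 \<le> hilbert_ratio x y"
  using inner_less_one[OF assms] norm_less_one_imp_sq[OF assms(1)]
  by (auto simp: hilbert_ratio_def intro!: divide_nonneg_pos)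

lemma artanh_divide_real:
  fixes p q :: real
  assumes "q \<noteq> 0"
  shows "2 * artanh (p / q) = ln ((q + p) / (q - p))"
proof -
  have "(1 + p / q) / (1 - p / q) = (q + p) / (q - p)"
    using assms by (simp add: field_split_simps)
  then show ?thesis
    by (simp add: artanh_def)
qed

text \<open>
  The fourth assumption gives uniqueness: it says that \<open>v\<close> is nearer to \<open>y\<close>, so the swapped pair
  \<open>(v, u)\<close> fails the ordering condition of \<open>chord_ends\<close>.
\<close>

lemma chord_ends_eqI:
  fixes x y u v :: "'a::euclidean_space"
  assumes "u \<noteq> v" "affine hull {x, y} \<inter> sphere 0 1 = {u, v}"
    and "norm (u - x) < norm (u - y)" "norm (v - y) < norm (v - x)"
  shows "chord_ends x y = (u, v)"
  unfolding chord_ends_def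
proof (rule the_equality)
  fix p
  assume p: "case p of (u', v') \<Rightarrow> u' \<noteq> v' \<and> affine hull {x, y} \<inter> sphere 0 1 = {u', v'} \<and>
                  norm (u' - x) < norm (u' - y)"
  then show "p = (u, v)"
    using assms by (cases p) (auto simp: doubleton_eq_iff)
qed (use assms in auto)

text \<open>
  The chord through \<open>x\<close> and \<open>y = x + d\<close> ends at \<open>x - \<alpha> *\<^sub>R d\<close> and \<open>x + \<beta> *\<^sub>R d\<close>, where \<open>- \<alpha>\<close> and \<open>\<beta>\<close> are
  the roots of \<open>(norm (x + s *\<^sub>R d))\<^sup>2 = 1\<close>, so the cross-ratio is \<open>((\<alpha> + 1) * \<beta>) / (\<alpha> * (\<beta> - 1))\<close>.
  Numerator and denominator both contain the product of the roots, which Vieta's formula turns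
  into \<open>k / t\<^sup>2\<close>. What remains is \<open>(w + S) / (w - S)\<close> with \<open>S / w\<close> the Hilbert ratio.
\<close>

lemma hilbert_dist_eq_artanh:
  fixes x y :: "'a::euclidean_space"
  assumes x: "norm x < 1" and y: "norm y < 1"
  shows "hilbert_dist x y = 2 * artanh (hilbert_ratio x y)"
proof (cases "x = y")
  case True
  then show ?thesis
    by (simp add: hilbert_dist_def hilbert_ratio_def)
next
  case False
  define d where "d = y - x"
  define c where "c = x \<bullet> d"
  define k where "k = 1 - (norm x)\<^sup>2"
  define t where "t = norm d"
  define S where "S = sqrt (c\<^sup>2 + k * t\<^sup>2)"
  define \<alpha> where "\<alpha> = (S + c) / t\<^sup>2"
  define \<beta> where "\<beta> = (S - c) / t\<^sup>2"
  have t: "t > 0"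
    using False by (simp add: t_def d_def)
  have k: "k > 0"
    using norm_less_one_imp_sq[OF x] by (simp add: k_def)
  have "c\<^sup>2 + k * t\<^sup>2 > c\<^sup>2"
    using t k by simp
  then have "S > \<bar>c\<bar>"
    unfolding S_def by (simp add: real_less_rsqrt)
  then have S: "S > c" "S > - c" "S > 0"
    by auto
  have S2: "S\<^sup>2 = c\<^sup>2 + k * t\<^sup>2"
    using t k by (simp add: S_def)
  have w: "1 - x \<bullet> y = k - c"
    by (simp add: k_def c_def d_def inner_diff_right power2_norm_eq_inner)
  have Q: "hilbert_ratio x y = S / (k - c)"
    by (simp add: hilbert_ratio_def w) (simp add: S_def c_def k_def t_def d_def)
  have wS: "S < k - c" "k - c > 0"
    using hilbert_ratio_less_one[OF x y] inner_less_one[OF x y]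
    by (simp_all add: Q flip: w)
  have \<alpha>: "\<alpha> > 0"
    using S t by (simp add: \<alpha>_def)
  have prod: "\<alpha> * \<beta> = k / t\<^sup>2"
    using S2 t by (simp add: \<alpha>_def \<beta>_def field_simps power2_eq_square)
  have \<beta>: "\<beta> > 0"
    using S t by (simp add: \<beta>_def)
  have num: "(\<alpha> + 1) * \<beta> = (k - c + S) / t\<^sup>2"
    using prod by (simp add: \<beta>_def ring_distribs add_divide_distrib diff_divide_distrib)
  have den: "\<alpha> * (\<beta> - 1) = (k - c - S) / t\<^sup>2"
    using prod by (simp add: \<alpha>_def ring_distribs add_divide_distrib diff_divide_distrib)
  \<comment> \<open>The end \<open>\<beta>\<close> lies beyond \<open>y\<close>, which is the parameter value 1, since the ratio is below 1.\<close>
  have "\<alpha> * (\<beta> - 1) > 0"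
    unfolding den using wS t by simp
  then have \<beta>1: "\<beta> > 1"
    using \<alpha> by (simp add: zero_less_mult_iff)
  define u where "u = x + (- \<alpha>) *\<^sub>R d"
  define v where "v = x + \<beta> *\<^sub>R d"
  have yd: "y = x + d"
    by (simp add: d_def)
  have dists: "norm (u - x) = \<alpha> * t" "norm (u - y) = (\<alpha> + 1) * t"
    "norm (x - v) = \<beta> * t" "norm (y - v) = (\<beta> - 1) * t"
  proof -
    have "u - x = (- \<alpha>) *\<^sub>R d" "u - y = (- (\<alpha> + 1)) *\<^sub>R d"
      "x - v = (- \<beta>) *\<^sub>R d" "y - v = (- (\<beta> - 1)) *\<^sub>R d"
      by (simp_all add: u_def v_def yd algebra_simps)
    then show "norm (u - x) = \<alpha> * t" "norm (u - y) = (\<alpha> + 1) * t"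
      "norm (x - v) = \<beta> * t" "norm (y - v) = (\<beta> - 1) * t"
      using \<alpha> \<beta>1 by (simp_all add: t_def)
  qed
  have on_sphere: "norm (x + s *\<^sub>R d) = 1 \<longleftrightarrow> s = - \<alpha> \<or> s = \<beta>" for s
  proof -
    have "norm (x + s *\<^sub>R d) = 1 \<longleftrightarrow> (norm (x + s *\<^sub>R d))\<^sup>2 = 1"
      by (simp add: power2_eq_1_iff) (smt (verit) norm_ge_zero)
    also have "\<dots> \<longleftrightarrow> s\<^sup>2 * t\<^sup>2 + 2 * s * c - k = 0"
      unfolding norm_affine_sq by (auto simp: c_def k_def t_def)
    also have "s\<^sup>2 * t\<^sup>2 + 2 * s * c - k = t\<^sup>2 * ((s + \<alpha>) * (s - \<beta>))"
    proof -
      have "(\<alpha> - \<beta>) * t\<^sup>2 = 2 * c" "\<alpha> * \<beta> * t\<^sup>2 = k"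
        using t by (simp_all add: prod) (simp add: \<alpha>_def \<beta>_def flip: diff_divide_distrib)
      moreover have "t\<^sup>2 * ((s + \<alpha>) * (s - \<beta>))
                     = s\<^sup>2 * t\<^sup>2 + s * ((\<alpha> - \<beta>) * t\<^sup>2) - \<alpha> * \<beta> * t\<^sup>2"
        by (simp add: power2_eq_square algebra_simps)
      ultimately show ?thesis
        by simp
    qed
    also have "\<dots> = 0 \<longleftrightarrow> s = - \<alpha> \<or> s = \<beta>"
      using t by (auto simp: add_eq_0_iff)
    finally show ?thesis .
  qed
  have "affine hull {x, y} \<inter> sphere 0 1 = {u, v}"
  proof -
    have "affine hull {x, y} \<inter> sphere 0 1 = {x + s *\<^sub>R d | s. norm (x + s *\<^sub>R d) = 1}"
      unfolding affine_hull_2_alt d_def[symmetric] by auto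
    also have "\<dots> = {u, v}"
      unfolding on_sphere u_def v_def by blast
    finally show ?thesis .
  qed
  moreover have "u \<noteq> v"
  proof
    assume "u = v"
    then have "(\<beta> + \<alpha>) *\<^sub>R d = 0"
      by (simp add: u_def v_def algebra_simps)
    then show False
      using \<alpha> \<beta> t by (simp add: t_def)
  qed
  ultimately have "chord_ends x y = (u, v)"
    using t by (intro chord_ends_eqI)
      (simp_all add: dists norm_minus_commute[of v])
  then have "hilbert_dist x y = ln (((\<alpha> + 1) * t * (\<beta> * t)) / (\<alpha> * t * ((\<beta> - 1) * t)))"
    using False by (simp add: hilbert_dist_def dists)
  also have "((\<alpha> + 1) * t * (\<beta> * t)) / (\<alpha> * t * ((\<beta> - 1) * t))
             = (((\<alpha> + 1) * \<beta>) * t\<^sup>2) / ((\<alpha> * (\<beta> - 1)) * t\<^sup>2)"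
    by (simp add: power2_eq_square ac_simps)
  also have "\<dots> = ((\<alpha> + 1) * \<beta>) / (\<alpha> * (\<beta> - 1))"
    using t by simp
  also have "\<dots> = (k - c + S) / (k - c - S)"
    unfolding num den using t by simp
  finally show ?thesis
    using wS by (simp add: Q artanh_divide_real)
qed

lemma artanh_real_less_iff:
  fixes p q :: real
  assumes "\<bar>p\<bar> < 1" "\<bar>q\<bar> < 1"
  shows "artanh p < artanh q \<longleftrightarrow> p < q"
proof -
  have "artanh p < artanh q \<longleftrightarrow> (1 + p) / (1 - p) < (1 + q) / (1 - q)"
    using assms unfolding artanh_def by (simp add: abs_less_iff)
  also have "\<dots> \<longleftrightarrow> p < q"
    using assms by (simp add: abs_less_iff field_simps)
  finally show ?thesis .
qed

section \<open>The ratio on a Euclidean sphere about the centre\<close>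

lemma hilbert_ratio_translate:
  fixes x d :: "'a::euclidean_space"
  shows "hilbert_ratio x (x + d) =
    sqrt ((x \<bullet> d)\<^sup>2 + (1 - (norm x)\<^sup>2) * (norm d)\<^sup>2) / ((1 - (norm x)\<^sup>2) - x \<bullet> d)"
  by (simp add: hilbert_ratio_def inner_add_right power2_norm_eq_inner algebra_simps)

lemma hilbert_ratio_outward:
  fixes x d :: "'a::euclidean_space"
  assumes "x \<bullet> d = norm x * norm d"
  shows "hilbert_ratio x (x + d) = norm d / ((1 - (norm x)\<^sup>2) - norm x * norm d)"
proof -
  have "(x \<bullet> d)\<^sup>2 + (1 - (norm x)\<^sup>2) * (norm d)\<^sup>2 = (norm d)\<^sup>2"
    unfolding assms by (simp add: algebra_simps power_mult_distrib)
  then show ?thesis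
    unfolding hilbert_ratio_translate assms by simp
qed

lemma hilbert_ratio_inward:
  fixes x d :: "'a::euclidean_space"
  assumes "x \<bullet> d = - (norm x * norm d)"
  shows "hilbert_ratio x (x + d) = norm d / ((1 - (norm x)\<^sup>2) + norm x * norm d)"
proof -
  have "(x \<bullet> d)\<^sup>2 + (1 - (norm x)\<^sup>2) * (norm d)\<^sup>2 = (norm d)\<^sup>2"
    unfolding assms by (simp add: algebra_simps power_mult_distrib)
  then show ?thesis
    unfolding hilbert_ratio_translate assms by simp
qed

text \<open>
  For \<open>d = t *\<^sub>R e\<close> with \<open>norm e = 1\<close> and \<open>t > 0\<close>, the condition on \<open>x \<bullet> d\<close> says that \<open>c = x \<bullet> e\<close> is \<open>- t\<close>,
  where the derivative of the ratio with respect to \<open>c\<close> vanishes. Geometrically,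
  \<open>d\<close> is orthogonal to \<open>x + d\<close>: the chord has its midpoint at \<open>x + d\<close>.
\<close>

lemma hilbert_ratio_critical:
  fixes x d :: "'a::euclidean_space"
  assumes x: "norm x < 1" and xd: "x \<bullet> d = - (norm d)\<^sup>2"
  shows "hilbert_ratio x (x + d) = norm d / sqrt ((norm d)\<^sup>2 + 1 - (norm x)\<^sup>2)"
proof -
  define D where "D = sqrt ((norm d)\<^sup>2 + 1 - (norm x)\<^sup>2)"
  have pos: "(norm d)\<^sup>2 + 1 - (norm x)\<^sup>2 > 0"
    using norm_less_one_imp_sq[OF x] by (smt (verit) zero_le_power2)
  have D: "D > 0" "D\<^sup>2 = (norm d)\<^sup>2 + 1 - (norm x)\<^sup>2"
    using pos by (simp_all add: D_def)
  have "(x \<bullet> d)\<^sup>2 + (1 - (norm x)\<^sup>2) * (norm d)\<^sup>2 = (norm d * D)\<^sup>2"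
    unfolding xd power_mult_distrib D(2) by (simp add: power2_eq_square algebra_simps)
  moreover have "1 - (norm x)\<^sup>2 - x \<bullet> d = D\<^sup>2"
    unfolding xd D(2) by simp
  ultimately show ?thesis
    using D(1) unfolding hilbert_ratio_translate D_def[symmetric]
    by (simp add: power2_eq_square abs_mult)
qed

text \<open>
  This lemma and the next remove root and denominators, so that the comparisons of ratios below
  become polynomial inequalities.
\<close>

lemma sqrt_div_le_div:
  fixes A p q w :: real
  assumes "0 \<le> p" "0 < q" "0 < w" "A * q\<^sup>2 \<le> p\<^sup>2 * w\<^sup>2"
  shows "sqrt A / w \<le> p / q"
proof -
  have "sqrt A * q \<le> p * w"
    using real_sqrt_le_mono[OF assms(4)] assms(1-3) by (simp add: real_sqrt_mult)
  then show ?thesis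
    using assms by (simp add: field_simps)
qed

lemma div_le_sqrt_div:
  fixes A p q w :: real
  assumes "0 \<le> p" "0 < q" "0 < w" "p\<^sup>2 * w\<^sup>2 \<le> A * q\<^sup>2"
  shows "p / q \<le> sqrt A / w"
proof -
  have "p * w \<le> sqrt A * q"
    using real_sqrt_le_mono[OF assms(4)] assms(1-3) by (simp add: real_sqrt_mult)
  then show ?thesis
    using assms by (simp add: field_simps)
qed

text \<open>
  Here \<open>c\<close> stands for \<open>x \<bullet> d\<close> and \<open>a\<close> for \<open>norm x\<close>. The difference of the cross-multiplied squares
  vanishes at \<open>c = a * t\<close>, where equality holds. Splitting off \<open>a * t - c\<close> leaves a factor that is
  nonnegative on the whole range \<open>\<bar>c\<bar> \<le> a * t\<close> given by the Cauchy-Schwarz inequality.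
\<close>

lemma hilbert_ratio_le_outward:
  fixes x d :: "'a::euclidean_space"
  assumes x: "norm x < 1" and d: "norm x * norm d < 1 - (norm x)\<^sup>2"
  shows "hilbert_ratio x (x + d) \<le> norm d / ((1 - (norm x)\<^sup>2) - norm x * norm d)"
proof -
  define a c t k where act: "a = norm x" "c = x \<bullet> d" "t = norm d" "k = 1 - a\<^sup>2"
  have t: "t \<ge> 0"
    by (simp add: act)
  have k: "k > 0"
    using norm_less_one_imp_sq[OF x] by (simp add: act)
  have "\<bar>c\<bar> \<le> a * t"
    unfolding act by (rule Cauchy_Schwarz_ineq2)
  then have c: "0 \<le> a * t - c" "0 \<le> a * t + c"
    by auto
  have m: "0 < k - a * t"
    using d by (simp add: act)
  have "t\<^sup>2 * (k - c)\<^sup>2 - (c\<^sup>2 + k * t\<^sup>2) * (k - a * t)\<^sup>2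
        = k * ((a * t - c) * ((t * a + t\<^sup>2) * (k - c) + (c + t\<^sup>2) * (k - a * t)))"
    unfolding act(4) by (simp add: power2_eq_square algebra_simps)
  moreover have "(t * a + t\<^sup>2) * (k - c) + (c + t\<^sup>2) * (k - a * t) \<ge> 0"
  proof -
    have "(t * a + t\<^sup>2) * (k - c) \<ge> (t * a + t\<^sup>2) * (k - a * t)"
      using c t by (intro mult_left_mono) (auto simp: act)
    moreover have "((t * a + t\<^sup>2) + (c + t\<^sup>2)) * (k - a * t) \<ge> 0"
      using c m by (intro mult_nonneg_nonneg) (auto simp: mult.commute)
    ultimately show ?thesis
      using distrib_right[of "t * a + t\<^sup>2" "c + t\<^sup>2" "k - a * t"] by linarith
  qed
  ultimately have "(c\<^sup>2 + k * t\<^sup>2) * (k - a * t)\<^sup>2 \<le> t\<^sup>2 * (k - c)\<^sup>2"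
    using k c by (smt (verit) mult_nonneg_nonneg)
  then have "sqrt (c\<^sup>2 + k * t\<^sup>2) / (k - c) \<le> t / (k - a * t)"
    using t m c by (intro sqrt_div_le_div) auto
  then show ?thesis
    by (simp add: hilbert_ratio_translate act)
qed

text \<open>
  The same factorisation at the other end \<open>c = - (a * t)\<close>. The remaining factor contains \<open>c + t\<^sup>2\<close>
  and \<open>t\<^sup>2 - a * t\<close>, which are nonnegative because the sphere of radius \<open>t\<close> about \<open>x\<close> has the
  origin inside or on it (\<open>a \<le> t\<close>).
\<close>

lemma hilbert_ratio_ge_inward:
  fixes x d :: "'a::euclidean_space"
  assumes x: "norm x < 1" and y: "norm (x + d) < 1" and d: "norm x \<le> norm d"
  shows "norm d / ((1 - (norm x)\<^sup>2) + norm x * norm d) \<le> hilbert_ratio x (x + d)"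
proof -
  define a c t k where act: "a = norm x" "c = x \<bullet> d" "t = norm d" "k = 1 - a\<^sup>2"
  have t: "t \<ge> 0" "a \<ge> 0" "a \<le> t"
    using d by (simp_all add: act)
  have k: "k > 0"
    using norm_less_one_imp_sq[OF x] by (simp add: act)
  have "\<bar>c\<bar> \<le> a * t"
    unfolding act by (rule Cauchy_Schwarz_ineq2)
  then have c: "0 \<le> c + a * t"
    by auto
  have "0 < 1 - x \<bullet> (x + d)"
    using inner_less_one[OF x y] by simp
  then have w: "0 < k - c"
    by (simp add: act inner_add_right power2_norm_eq_inner)
  have at: "a * t \<ge> 0" "a * t \<le> t\<^sup>2"
    using t by (auto simp: power2_eq_square intro: mult_right_mono)
  have "0 \<le> (c + t\<^sup>2) * (k + a * t)" "0 \<le> (t\<^sup>2 - a * t) * (k - c)"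
    using k w c at by simp_all
  have "(c\<^sup>2 + k * t\<^sup>2) * (k + a * t)\<^sup>2 - t\<^sup>2 * (k - c)\<^sup>2
        = k * ((c + a * t) * ((c + t\<^sup>2) * (k + a * t) + (t\<^sup>2 - a * t) * (k - c)))"
    unfolding act(4) by (simp add: power2_eq_square algebra_simps)
  also have "\<dots> \<ge> 0"
    using k c \<open>0 \<le> (c + t\<^sup>2) * (k + a * t)\<close> \<open>0 \<le> (t\<^sup>2 - a * t) * (k - c)\<close>
    by (intro mult_nonneg_nonneg) linarith+
  finally have "t / (k + a * t) \<le> sqrt (c\<^sup>2 + k * t\<^sup>2) / (k - c)"
    using t k w at(1) by (intro div_le_sqrt_div) linarith+
  then show ?thesis
    by (simp add: hilbert_ratio_translate act)
qed

text \<open>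
  On the sphere of radius \<open>r\<close> the difference of the cross-multiplied squares is \<open>k * (c + r\<^sup>2)\<^sup>2\<close>
  with \<open>c = x \<bullet> d\<close>. Outside that sphere, with \<open>c\<close> kept fixed, the ratio is only larger.
\<close>

lemma hilbert_ratio_ge_critical:
  fixes x d :: "'a::euclidean_space"
  assumes x: "norm x < 1" and y: "norm (x + d) < 1" and r: "0 \<le> r" "r \<le> norm d"
  shows "r / sqrt (r\<^sup>2 + 1 - (norm x)\<^sup>2) \<le> hilbert_ratio x (x + d)"
proof -
  define c k where ck: "c = x \<bullet> d" "k = 1 - (norm x)\<^sup>2"
  have k: "k > 0"
    using norm_less_one_imp_sq[OF x] by (simp add: ck)
  have "0 < 1 - x \<bullet> (x + d)"
    using inner_less_one[OF x y] by simp
  then have w: "0 < k - c"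
    by (simp add: ck inner_add_right power2_norm_eq_inner)
  have rk: "r\<^sup>2 + k > 0"
    using k by (simp add: add_nonneg_pos)
  have "(c\<^sup>2 + k * r\<^sup>2) * (r\<^sup>2 + k) - r\<^sup>2 * (k - c)\<^sup>2 = k * (c + r\<^sup>2)\<^sup>2"
    by (simp add: power2_eq_square algebra_simps)
  also have "\<dots> \<ge> 0"
    using k by simp
  finally have "r / sqrt (r\<^sup>2 + k) \<le> sqrt (c\<^sup>2 + k * r\<^sup>2) / (k - c)"
    using r w rk by (intro div_le_sqrt_div) auto
  also have "\<dots> \<le> sqrt (c\<^sup>2 + k * (norm d)\<^sup>2) / (k - c)"
    using r k w by (intro divide_right_mono real_sqrt_le_mono add_left_mono mult_left_mono power_mono) auto
  finally show ?thesis
    by (simp add: hilbert_ratio_translate ck add_diff_eq)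
qed

lemma outward_ratio_less_iff:
  fixes a k s t :: real
  assumes "0 < k" "a * s < k" "a * t < k"
  shows "s / (k - a * s) < t / (k - a * t) \<longleftrightarrow> s < t"
  using assms by (simp add: field_simps)

lemma inward_ratio_mono:
  fixes a k s t :: real
  assumes "0 < k" "0 \<le> a" "0 \<le> s" "s \<le> t"
  shows "s / (k + a * s) \<le> t / (k + a * t)"
proof -
  have "k + a * s > 0" "k + a * t > 0"
    using assms by (auto intro!: add_pos_nonneg)
  then show ?thesis
    using assms by (simp add: field_simps)
qed

text \<open>
  For \<open>a = norm x\<close> this keeps the greatest ratio on \<open>sphere x r\<close>, namely
  \<open>r / (1 - a\<^sup>2 - a * r)\<close>, below 1 while that sphere lies inside the unit ball.
\<close>

lemma radius_less_outward_denominator: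
  fixes a r :: real
  assumes "0 \<le> a" "0 < r" "r < 1 - a"
  shows "r < 1 - a\<^sup>2 - a * r"
proof -
  have "r * (1 + a) < (1 - a) * (1 + a)"
    using assms by (intro mult_strict_right_mono) auto
  then show ?thesis
    by (simp add: power2_eq_square algebra_simps)
qed

section \<open>Realising prescribed directions and distances\<close>

text \<open>
  The sphere is connected in dimension at least two, so \<open>x \<bullet> d\<close> takes every value between those
  at the two multiples of \<open>x\<close>. This is where the dimension matters: on the line, \<open>x \<bullet> d\<close> has only
  the two extreme values.
\<close>

lemma ex_vector_with_norm_and_inner:
  fixes x :: "'a::euclidean_space"
  assumes dim: "2 \<le> DIM('a)" and r: "0 \<le> r" and c: "\<bar>c\<bar> \<le> norm x * r"
  obtains d where "norm d = r" "x \<bullet> d = c"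
proof -
  obtain e :: 'a where e: "norm e = r" "x \<bullet> e = norm x * r"
  proof (cases "x = 0")
    case True
    obtain e :: 'a where "norm e = r"
      using vector_choose_size[OF r] by blast
    then show ?thesis
      using True that by simp
  next
    case False
    then show ?thesis
      using r by (intro that[of "(r / norm x) *\<^sub>R x"])
        (auto simp: power2_eq_square simp flip: power2_norm_eq_inner)
  qed
  have "connected (sphere (0::'a) r)"
    using dim by (rule connected_sphere)
  then have "\<exists>d\<in>sphere 0 r. x \<bullet> d = c"
    using connected_ivt_hyperplane[of "sphere 0 r" "- e" e x c] e c by auto
  then obtain d where "d \<in> sphere 0 r" "x \<bullet> d = c"
    by blast
  then show thesis
    using that by simp
qed

text \<open>
  In the outward direction every Hilbert distance occurs. This yields both the sharpness of the
  bound on \<open>l1\<close> and the unboundedness of the metric.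
\<close>

lemma ex_outward_at_hilbert_dist:
  fixes x :: "'a::euclidean_space"
  assumes x: "norm x < 1" and l: "0 \<le> l"
  obtains d where "x \<bullet> d = norm x * norm d" "norm (x + d) < 1" "hilbert_dist x (x + d) = l"
proof -
  \<comment> \<open>\<open>t\<close> is the solution of \<open>t / (k - a * t) = \<tau>\<close>.\<close>
  define a \<tau> k t where act: "a = norm x" "\<tau> = tanh (l / 2)" "k = 1 - a\<^sup>2" "t = \<tau> * k / (1 + \<tau> * a)"
  have \<tau>: "0 \<le> \<tau>" "\<tau> < 1"
    using l by (auto simp: act tanh_real_lt_1)
  have a: "0 \<le> a" "a < 1"
    using x by (simp_all add: act)
  have k: "k > 0" "k = (1 - a) * (1 + a)"
    using norm_less_one_imp_sq[OF x] by (simp_all add: act power2_eq_square algebra_simps)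
  have q: "1 + \<tau> * a > 0"
    using \<tau> a by (simp add: add_pos_nonneg)
  have t0: "t \<ge> 0"
    using \<tau> k q by (simp add: act(4))
  have t1: "a + t < 1"
  proof -
    have "\<tau> * k < (1 - a) * (1 + \<tau> * a)"
      using mult_strict_left_mono[of \<tau> 1 "1 - a"] a \<tau> unfolding k(2) by (simp add: algebra_simps)
    then show ?thesis
      using q by (simp add: act(4) field_simps)
  qed
  have "k - a * t = k / (1 + \<tau> * a)"
    using q by (simp add: act(4) field_simps)
  then have ratio: "t / (k - a * t) = \<tau>"
    using q k(1) by (simp add: act(4))
  obtain e :: 'a where e: "norm e = 1" "x = a *\<^sub>R e"
  proof (cases "x = 0")
    case True
    obtain e :: 'a where "norm e = 1"
      using vector_choose_size[of 1] by auto
    then show ?thesis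
      using True that by (simp add: act)
  next
    case False
    then show ?thesis
      by (intro that[of "x /\<^sub>R norm x"]) (auto simp: act)
  qed
  define d where "d = t *\<^sub>R e"
  have nd: "norm d = t"
    using e t0 by (simp add: d_def)
  have "x \<bullet> d = a * t"
    using e by (simp add: d_def dot_square_norm)
  then have xd: "x \<bullet> d = norm x * norm d"
    by (simp add: nd flip: act(1))
  have y: "norm (x + d) < 1"
    using norm_triangle_ineq[of x d] t1 nd by (simp add: act)
  have "hilbert_ratio x (x + d) = \<tau>"
    using hilbert_ratio_outward[OF xd] ratio nd by (simp add: act)
  then have "hilbert_dist x (x + d) = l"
    by (simp add: hilbert_dist_eq_artanh[OF x y] act artanh_tanh_real)
  then show thesis
    using that xd y by blast
qed

lemma hilbert_ball_psubset_ball: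
  fixes x :: "'a::euclidean_space"
  assumes "norm x < 1"
  shows "hilbert_ball x l \<subset> ball 0 1"
proof -
  obtain d where "norm (x + d) < 1" "hilbert_dist x (x + d) = max l 0"
    using ex_outward_at_hilbert_dist[OF assms, of "max l 0"] by auto
  then have "x + d \<in> ball 0 1" "x + d \<notin> hilbert_ball x l"
    by (simp_all add: hilbert_ball_def)
  moreover have "hilbert_ball x l \<subseteq> ball 0 1"
    unfolding hilbert_ball_def by (rule Collect_subset)
  ultimately show ?thesis
    by blast
qed

section \<open>Comparing the balls\<close>

text \<open>
  If the bound fails, \<open>ex_outward_at_hilbert_dist\<close> supplies a point at Hilbert distance exactly
  \<open>max l 0\<close> in the outward direction. It lies in the Euclidean ball, since the ratio increases
  along that radius, but not in the Hilbert ball. The maximum with 0 covers negative \<open>l\<close>, where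
  the point is \<open>x\<close> itself.
\<close>

lemma ball_subset_hilbert_ball_iff:
  fixes x :: "'a::euclidean_space"
  assumes x: "norm x < 1" and r: "0 < r" "r < 1 - norm x"
  shows "ball x r \<subseteq> hilbert_ball x l \<longleftrightarrow> 2 * artanh (r / ((1 - (norm x)\<^sup>2) - norm x * r)) \<le> l"
proof -
  define a k \<rho> where ak: "a = norm x" "k = 1 - a\<^sup>2" "\<rho> = r / (k - a * r)"
  have a: "0 \<le> a" "a < 1" "r < 1 - a"
    using x r by (simp_all add: ak)
  have k: "k > 0"
    using norm_less_one_imp_sq[OF x] by (simp add: ak)
  have ra: "r < k - a * r" "a * r < k"
    using radius_less_outward_denominator[OF a(1) r(1) a(3)] r(1) by (simp_all add: ak)
  have \<rho>: "0 < \<rho>" "\<rho> < 1"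
    using ra r by (simp_all add: ak(3))
  have "ball x r \<subseteq> hilbert_ball x l \<longleftrightarrow> 2 * artanh \<rho> \<le> l"
  proof
    assume l: "2 * artanh \<rho> \<le> l"
    show "ball x r \<subseteq> hilbert_ball x l"
    proof
      fix y assume "y \<in> ball x r"
      define d where "d = y - x"
      have yd: "y = x + d"
        by (simp add: d_def)
      have d: "norm d < r"
        using \<open>y \<in> ball x r\<close> by (simp add: d_def dist_norm norm_minus_commute)
      have y: "norm y < 1"
        using norm_triangle_ineq[of x d] d a unfolding yd ak by linarith
      have ad: "a * norm d < k"
        using mult_left_mono[of "norm d" r a] d a ra by simp
      have "hilbert_ratio x y \<le> norm d / (k - a * norm d)"
        using hilbert_ratio_le_outward[OF x, of d] ad unfolding yd ak by simp
      also have "\<dots> < \<rho>"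
        unfolding ak(3) using outward_ratio_less_iff[OF k ad ra(2)] d by simp
      finally have "artanh (hilbert_ratio x y) < artanh \<rho>"
        using hilbert_ratio_nonneg[OF x y] \<rho> by (subst artanh_real_less_iff) auto
      then show "y \<in> hilbert_ball x l"
        using l y by (simp add: hilbert_ball_def hilbert_dist_eq_artanh[OF x y])
    qed
  next
    assume sub: "ball x r \<subseteq> hilbert_ball x l"
    show "2 * artanh \<rho> \<le> l"
    proof (rule ccontr)
      assume "\<not> 2 * artanh \<rho> \<le> l"
      moreover have "artanh \<rho> > 0"
        using artanh_real_less_iff[of 0 \<rho>] \<rho> by simp
      ultimately have L: "max l 0 < 2 * artanh \<rho>"
        by simp
      obtain d where d: "x \<bullet> d = norm x * norm d" "norm (x + d) < 1"
        "hilbert_dist x (x + d) = max l 0"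
        using ex_outward_at_hilbert_dist[OF x, of "max l 0"] by auto
      have "hilbert_ratio x (x + d) < \<rho>"
        using L d hilbert_ratio_nonneg[OF x d(2)] hilbert_ratio_less_one[OF x d(2)] \<rho>
        by (simp add: hilbert_dist_eq_artanh[OF x d(2)] artanh_real_less_iff flip: d(3))
      then have "norm d / (k - a * norm d) < r / (k - a * r)"
        using hilbert_ratio_outward[OF d(1)] by (simp add: ak)
      moreover have "a * norm d < k"
        using inner_less_one[OF x d(2)] d(1)
        by (simp add: ak inner_add_right power2_norm_eq_inner)
      ultimately have "norm d < r"
        using outward_ratio_less_iff[OF k _ ra(2)] by blast
      then have "x + d \<in> hilbert_ball x l"
        using sub by (auto simp: dist_norm)
      then show False
        using d by (simp add: hilbert_ball_def)
    qed
  qed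
  then show ?thesis
    by (simp add: ak)
qed

text \<open>
  The least ratio outside the open Euclidean ball decides the inclusion once it is attained at
  some \<open>z\<close> on the bounding sphere: a larger Hilbert ball would contain \<open>z\<close>.
\<close>

lemma hilbert_ball_subset_ball_iff:
  fixes x z :: "'a::euclidean_space"
  assumes x: "norm x < 1" and z: "norm z < 1" "dist x z = r"
    and least: "\<And>y. norm y < 1 \<Longrightarrow> r \<le> dist x y \<Longrightarrow> hilbert_ratio x z \<le> hilbert_ratio x y"
  shows "hilbert_ball x l \<subseteq> ball x r \<longleftrightarrow> l \<le> 2 * artanh (hilbert_ratio x z)"
proof
  assume sub: "hilbert_ball x l \<subseteq> ball x r"
  have "z \<notin> ball x r"
    using z by simp
  then have "z \<notin> hilbert_ball x l"
    using sub by blast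
  then show "l \<le> 2 * artanh (hilbert_ratio x z)"
    using z by (simp add: hilbert_ball_def hilbert_dist_eq_artanh[OF x])
next
  assume l: "l \<le> 2 * artanh (hilbert_ratio x z)"
  show "hilbert_ball x l \<subseteq> ball x r"
  proof
    fix y assume "y \<in> hilbert_ball x l"
    then have y: "norm y < 1" and "artanh (hilbert_ratio x y) < artanh (hilbert_ratio x z)"
      using l hilbert_dist_eq_artanh[OF x, of y] by (auto simp: hilbert_ball_def)
    then have "hilbert_ratio x y < hilbert_ratio x z"
      using hilbert_ratio_nonneg[OF x] hilbert_ratio_less_one[OF x] z
      by (subst (asm) artanh_real_less_iff) auto
    then show "y \<in> ball x r"
      using least[OF y] by force
  qed
qed

lemma hilbert_ball_subset_ball_iff_inward:
  fixes x :: "'a::euclidean_space"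
  assumes dim: "2 \<le> DIM('a)" and r: "0 < r" "r < 1 - norm x" and xr: "norm x \<le> r"
  shows "hilbert_ball x l \<subseteq> ball x r \<longleftrightarrow> l \<le> 2 * artanh (r / ((1 - (norm x)\<^sup>2) + norm x * r))"
proof -
  have x: "norm x < 1"
    using r by simp
  obtain d where d: "norm d = r" "x \<bullet> d = - (norm x * r)"
    using ex_vector_with_norm_and_inner[OF dim, of r "- (norm x * r)" x] r by auto
  have z: "norm (x + d) < 1"
    using norm_triangle_ineq[of x d] d r by simp
  have Q: "hilbert_ratio x (x + d) = r / ((1 - (norm x)\<^sup>2) + norm x * r)"
    using hilbert_ratio_inward[of x d] d by simp
  have "hilbert_ratio x (x + d) \<le> hilbert_ratio x y" if y: "norm y < 1" "r \<le> dist x y" for y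
  proof -
    have "r \<le> norm (y - x)"
      using y by (simp add: dist_norm norm_minus_commute)
    then have "r / ((1 - (norm x)\<^sup>2) + norm x * r)
               \<le> norm (y - x) / ((1 - (norm x)\<^sup>2) + norm x * norm (y - x))"
      using norm_less_one_imp_sq[OF x] r by (intro inward_ratio_mono) auto
    also have "\<dots> \<le> hilbert_ratio x y"
      using hilbert_ratio_ge_inward[OF x, of "y - x"] y xr \<open>r \<le> norm (y - x)\<close> by simp
    finally show ?thesis
      by (simp add: Q)
  qed
  then show ?thesis
    using hilbert_ball_subset_ball_iff[OF x z, of r l] d by (simp add: dist_norm Q)
qed

lemma hilbert_ball_subset_ball_iff_critical:
  fixes x :: "'a::euclidean_space"
  assumes dim: "2 \<le> DIM('a)" and r: "0 < r" "r < 1 - norm x" and xr: "r \<le> norm x"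
  shows "hilbert_ball x l \<subseteq> ball x r \<longleftrightarrow> l \<le> 2 * artanh (r / sqrt (r\<^sup>2 + 1 - (norm x)\<^sup>2))"
proof -
  have x: "norm x < 1"
    using r by simp
  have "\<bar>- r\<^sup>2\<bar> \<le> norm x * r"
    using r xr by (simp add: power2_eq_square mult_right_mono)
  then obtain d where d: "norm d = r" "x \<bullet> d = - r\<^sup>2"
    using ex_vector_with_norm_and_inner[OF dim, of r "- r\<^sup>2" x] r by auto
  have z: "norm (x + d) < 1"
    using norm_triangle_ineq[of x d] d r by simp
  have Q: "hilbert_ratio x (x + d) = r / sqrt (r\<^sup>2 + 1 - (norm x)\<^sup>2)"
    using hilbert_ratio_critical[OF x, of d] d by simp
  have "hilbert_ratio x (x + d) \<le> hilbert_ratio x y" if y: "norm y < 1" "r \<le> dist x y" for y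
    using hilbert_ratio_ge_critical[OF x, of "y - x" r] y r
    by (simp add: Q dist_norm norm_minus_commute)
  then show ?thesis
    using hilbert_ball_subset_ball_iff[OF x z, of r l] d by (simp add: dist_norm Q)
qed

theorem lemma5p1:
  fixes x :: "real ^ 'n" and r l0 l1 :: real
  assumes "CARD('n) \<ge> 2"
    and "x \<in> ball 0 1"
    and "0 < r" and "r < 1 - norm x"
  shows "(hilbert_ball x l0 \<subseteq> ball x r \<and> ball x r \<subseteq> hilbert_ball x l1 \<and>
          hilbert_ball x l1 \<subset> ball 0 1) \<longleftrightarrow>
    (l0 \<le> (if norm x \<le> r
            then ln (((1 + norm x) * (1 - norm x + r)) / ((1 - norm x) * (1 + norm x - r)))
            else ln (((1 - (norm x)\<^sup>2) * sqrt (r\<^sup>2 + 1 - (norm x)\<^sup>2)) /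
                     ((sqrt (r\<^sup>2 + 1 - (norm x)\<^sup>2) - r) *
                      (1 - (norm x)\<^sup>2 - r * (sqrt (r\<^sup>2 + 1 - (norm x)\<^sup>2) - r))))) \<and>
     l1 \<ge> ln (((1 - norm x) * (1 + norm x + r)) / ((1 + norm x) * (1 - norm x - r))))"
proof -
  define a k D where akD: "a = norm x" "k = 1 - a\<^sup>2" "D = sqrt (r\<^sup>2 + k)"
  have x: "norm x < 1"
    using assms by simp
  have dim: "2 \<le> DIM(real ^ 'n)"
    using assms by simp
  have r: "0 < r" "r < 1 - a" and a: "0 \<le> a" "a < 1"
    using assms by (simp_all add: akD)
  have k: "k > 0"
    using norm_less_one_imp_sq[OF x] by (simp add: akD)
  have ar: "a * r < k"
    using radius_less_outward_denominator[OF a(1) r] r(1) by (simp add: akD)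
  have D2: "D\<^sup>2 = r\<^sup>2 + k"
    using k by (simp add: akD(3))
  have D: "D > r"
    unfolding akD(3) using k by (simp add: real_less_rsqrt)
  have outward: "2 * artanh (r / (k - a * r)) = ln (((1 - a) * (1 + a + r)) / ((1 + a) * (1 - a - r)))"
    using ar by (subst artanh_divide_real) (simp_all add: akD(2) power2_eq_square algebra_simps)
  have inward: "2 * artanh (r / (k + a * r)) = ln (((1 + a) * (1 - a + r)) / ((1 - a) * (1 + a - r)))"
  proof -
    have "k + a * r > 0"
      using k r a by (simp add: add_pos_nonneg)
    then show ?thesis
      by (subst artanh_divide_real) (simp_all add: akD(2) power2_eq_square algebra_simps)
  qed
  have critical: "2 * artanh (r / D) = ln ((k * D) / ((D - r) * (k - r * (D - r))))"
  proof -
    have "k = (D + r) * (D - r)" "k - r * (D - r) = (D - r) * D"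
      using D2 by (simp_all add: power2_eq_square algebra_simps)
    then have "(k * D) / ((D - r) * (k - r * (D - r)))
        = ((D + r) * ((D - r) * D)) / ((D - r) * ((D - r) * D))"
      by (simp only: mult.assoc)
    also have "\<dots> = (D + r) / (D - r)"
      using D r by simp
    finally have "(k * D) / ((D - r) * (k - r * (D - r))) = (D + r) / (D - r)" .
    then show ?thesis
      using D r by (subst artanh_divide_real) simp_all
  qed
  have D': "sqrt (r\<^sup>2 + 1 - a\<^sup>2) = D"
    by (simp add: akD(2,3) add_diff_eq)
  show ?thesis
    unfolding akD(1)[symmetric] akD(2)[symmetric] D' inward[symmetric] outward[symmetric] critical[symmetric]
    using hilbert_ball_psubset_ball[OF x, of l1]
      ball_subset_hilbert_ball_iff[OF x assms(3,4), of l1]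
      hilbert_ball_subset_ball_iff_inward[OF dim assms(3,4), of l0]
      hilbert_ball_subset_ball_iff_critical[OF dim assms(3,4), of l0]
    unfolding akD(1)[symmetric] akD(2)[symmetric] D'
    by auto
qed

end
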